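(* Consider the piecewise-constant linear time-varying system $$x_{t+1}=A_ix_t+B_iu_t+w_t,\qquad T_i\le t<T_{i+1},\quad i\in\mathbb{N},$$ with dwell time $\tau$, i.e. $T_{i+1}-T_i\ge\tau$ for all $i\in\mathbb{N}$. Suppose that: (1) every pair $(A_i,B_i)$ is controllable; (2) there are constants $a_m,b_m$ and $w_m\ge0$ such that $\|A_i\|\le a_m$, $\|B_i\|\le b_m$ for all $i$, and $\|w_t\|\le w_m$ for all $t\in\mathbb{N}$; (3) there is $\delta>0$ such that $\|[B_i,A_i]-[B_{i-1},A_{i-1}]\|\le\delta$ for all $i\ge1$; (4) the probing signal $e_t$ is chosen such that there are constants $e_m>0$ and $\gamma>0$ with $\underline{\sigma}\big(\tfrac1L\bar D_t\bar D_t^\top\big)\ge\gamma^2$ for all $t\ge t_0$, and $\|e_t\|\le e_m$ for all $t\ge0$. Let $N=\lceil L/\tau\rceil$, the maximal number of switches during a sliding window of length $L$. Then, for all $i\in\mathbb{N}$ and all $T_i\le t<T_{i+1}$, the normalized least-squares estimate $[\hat B_t,\hat A_t]=\arg\min_{B,A}\|\bar X_{t+1}-[B,A]\bar D_t\|_F$ satisfies $$\|[\hat B_t,\hat A_t]-[B_i,A_i]\|\le\frac{N\delta}{\gamma}+\frac{w_m}{\gamma}.$$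
   Context: $\|\cdot\|$ is the Euclidean norm of vectors and the spectral norm of matrices, $\|\cdot\|_F$ the Frobenius norm, $\underline{\sigma}(\cdot)$ the minimum singular value, $M^\dagger$ the Moore–Penrose pseudoinverse. $x_t\in\mathbb{R}^n$ is the state, $u_t\in\mathbb{R}^m$ the input, $w_t\in\mathbb{R}^n$ the process noise. The matrices $(A_i,B_i)$ are unknown, and $\{T_i\}$ are the unknown switching instants at which the dynamics jump from $(A_{i-1},B_{i-1})$ to $(A_i,B_i)$; $\tau$ is a positive integer, and the initial time is $t_0=T_0$. The input has the form $u_t=K_tx_t+e_t$ with a state-feedback gain $K_t\in\mathbb{R}^{m\times n}$ and a probing signal $e_t$; the procedure is initialized at $t_0$ with a window of offline data. The window length is an integer $L\ge m+n$. The data used at time $t$ are the $L$ most recent samples: let $d_s=[u_s^\top,x_s^\top]^\top$, $n_s=\sqrt{1+\|d_s\|^2}$, $D_t=[d_{t-L},\dots,d_{t-1}]\in\mathbb{R}^{(m+n)\times L}$, $X_{t+1}=[x_{t-L+1},\dots,x_t]\in\mathbb{R}^{n\times L}$, $N_t=\mathrm{diag}(n_{t-L},\dots,n_{t-1})$, $\bar D_t=D_tN_t^{-1}$, $\bar X_{t+1}=X_{t+1}N_t^{-1}$. The minimizer is $[\hat B_t,\hat A_t]=\bar X_{t+1}\bar D_t^\dagger$.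
   Formalization: The offline samples at times t_0−L,…,t_0−1 are assumed to be generated by the first mode (A_0,B_0) with noise bounded by w_m; with arbitrary offline data the bound can fail for T_0≤t<T_0+L. *)

theory Defs
  imports "HOL-Analysis.Analysis"
begin

text \<open>
  On matrices, the library's \<open>norm\<close> is the Frobenius norm; the spectral norm is the operator
  norm induced by the Euclidean norm.
\<close>

definition spectral_norm :: "real^'c^'r \<Rightarrow> real" where
  "spectral_norm M = onorm (\<lambda>v. M *v v)"

text \<open>
  Singular values are the nonnegative square roots of the eigenvalues of the Gram matrix. For a
  square matrix this set is finite and nonempty and contains every singular value, including
  \<open>0\<close> in the singular case.
\<close>

definition singular_values :: "real^'k^'k \<Rightarrow> real set" where
  "singular_values M =
    {s. 0 \<le> s \<and> (\<exists>v. v \<noteq> 0 \<and> (transpose M ** M) *v v = s\<^sup>2 *\<^sub>R v)}"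

definition min_singular_value :: "real^'k^'k \<Rightarrow> real" where
  "min_singular_value M = Min (singular_values M)"

text \<open>
  Discrete-time controllability: every state can be steered to every state in finitely many steps.
\<close>

definition controllable :: "real^'n^'n \<Rightarrow> real^'m^'n \<Rightarrow> bool" where
  "controllable A B \<longleftrightarrow>
    (\<forall>x0 xf. \<exists>(k::nat) (u :: nat \<Rightarrow> real^'m) (x :: nat \<Rightarrow> real^'n).
      x 0 = x0 \<and> x k = xf \<and> (\<forall>j<k. x (Suc j) = A *v x j + B *v u j))"

text \<open>The block row \<open>[B, A]\<close> and the stacked vector \<open>[u\<^sup>T, x\<^sup>T]\<^sup>T\<close>.\<close>

definition hcat :: "real^'m^'n \<Rightarrow> real^'k^'n \<Rightarrow> real^('m + 'k)^'n" where
  "hcat B A = (\<chi> i j. case j of Inl p \<Rightarrow> B $ i $ p | Inr q \<Rightarrow> A $ i $ q)"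

definition vstack :: "real^'m \<Rightarrow> real^'k \<Rightarrow> real^('m + 'k)" where
  "vstack u x = (\<chi> j. case j of Inl p \<Rightarrow> u $ p | Inr q \<Rightarrow> x $ q)"

text \<open>
  The columns of the data matrices are indexed by a finite linearly ordered type \<open>'l\<close>, whose
  cardinality is the window length; \<open>colpos\<close> numbers them \<open>0, \<dots>, CARD('l) - 1\<close> from left to
  right. The column at position \<open>p\<close> belongs to sample time \<open>t - CARD('l) + p\<close>, so the
  definitions below are meaningful for \<open>t \<ge> CARD('l)\<close> only (subtraction on naturals truncates).
\<close>

definition colpos :: "'l::{finite,linorder} \<Rightarrow> nat" where
  "colpos k = card {j. j < k}"

definition sample_time :: "nat \<Rightarrow> 'l::{finite,linorder} \<Rightarrow> nat" where
  "sample_time t k = t - CARD('l) + colpos k"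

definition nfac :: "(nat \<Rightarrow> real^'m) \<Rightarrow> (nat \<Rightarrow> real^'n) \<Rightarrow> nat \<Rightarrow> real" where
  "nfac u x s = sqrt (1 + (norm (vstack (u s) (x s)))\<^sup>2)"

definition D_mat ::
  "(nat \<Rightarrow> real^'m) \<Rightarrow> (nat \<Rightarrow> real^'n) \<Rightarrow> nat \<Rightarrow> real^'l::{finite,linorder}^('m + 'n)" where
  "D_mat u x t = (\<chi> i k. vstack (u (sample_time t k)) (x (sample_time t k)) $ i)"

text \<open>\<open>Xnext_mat x t\<close> is the matrix of successor states \<open>X\<^sub>t\<^sub>+\<^sub>1 = [x\<^sub>t\<^sub>-\<^sub>L\<^sub>+\<^sub>1, \<dots>, x\<^sub>t]\<close>.\<close>

definition Xnext_mat ::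
  "(nat \<Rightarrow> real^'n) \<Rightarrow> nat \<Rightarrow> real^'l::{finite,linorder}^'n" where
  "Xnext_mat x t = (\<chi> i k. x (Suc (sample_time t k)) $ i)"

definition N_mat ::
  "(nat \<Rightarrow> real^'m) \<Rightarrow> (nat \<Rightarrow> real^'n) \<Rightarrow> nat \<Rightarrow> real^'l::{finite,linorder}^'l::{finite,linorder}" where
  "N_mat u x t = (\<chi> j k. if j = k then nfac u x (sample_time t k) else 0)"

definition Dbar ::
  "(nat \<Rightarrow> real^'m) \<Rightarrow> (nat \<Rightarrow> real^'n) \<Rightarrow> nat \<Rightarrow> real^'l::{finite,linorder}^('m + 'n)" where
  "Dbar u x t = D_mat u x t ** matrix_inv (N_mat u x t)"

definition Xbar_next ::
  "(nat \<Rightarrow> real^'m) \<Rightarrow> (nat \<Rightarrow> real^'n) \<Rightarrow> nat \<Rightarrow> real^'l::{finite,linorder}^'n" where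
  "Xbar_next u x t = Xnext_mat x t ** matrix_inv (N_mat u x t)"

definition ls_estimate ::
  "real^'l^'n \<Rightarrow> real^'l^('m + 'n) \<Rightarrow> (real^'m^'n) \<times> (real^'n^'n)" where
  "ls_estimate X D = (ARG_MIN (\<lambda>(B, A). norm (X - hcat B A ** D)) BA. True)"

end

theory Submission
  imports Defs
begin

text \<open>
  The residual \<open>X\<close> minus \<open>[B\<^sub>i, A\<^sub>i] D\<close> of the current parameters has normalised columns
  \<open>(([B\<^sub>j, A\<^sub>j] - [B\<^sub>i, A\<^sub>i]) d\<^sub>s + w\<^sub>s) / n\<^sub>s\<close>, where \<open>j\<close> is the mode active at time \<open>s\<close>. The dwell time
  forces \<open>i - j \<le> N\<close>, so its Frobenius norm is at most \<open>sqrt L * (N \<delta> + w\<^sub>m)\<close>. The least-squares fit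
  is the orthogonal projection of \<open>X\<close> onto the subspace of all products \<open>\<Theta> D\<close>, and projections
  are nonexpansive, so \<open>(\<Theta> - [B\<^sub>i, A\<^sub>i]) D\<close> obeys the same bound for the estimate \<open>\<Theta>\<close>. Excitation says
  that right multiplication by \<open>D\<close> expands Frobenius norms by at least \<open>sqrt L * \<gamma>\<close>.
\<close>

subsection \<open>Singular values of positive semidefinite matrices\<close>

text \<open>Compactness of the sphere gives a unit minimiser of the quadratic form. It is an
  eigenvector since the first variation vanishes at a minimum.\<close>

lemma min_eigenvector:
  fixes M :: "real^'k^'k"
  assumes sym: "transpose M = M"
  obtains v \<mu> where "norm v = 1" "M *v v = \<mu> *\<^sub>R v" "\<And>w. \<mu> * (w \<bullet> w) \<le> w \<bullet> (M *v w)"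
proof -
  let ?f = "\<lambda>w. w \<bullet> (M *v w)"
  have swap: "a \<bullet> (M *v b) = b \<bullet> (M *v a)" for a b
    by (metis dot_lmul_matrix inner_commute sym transpose_matrix_vector)
  have "continuous_on (sphere 0 1) ?f"
    by (intro continuous_intros linear_continuous_on matrix_vector_mul_bounded_linear)
  then obtain v where v: "norm v = 1" and min: "\<And>w. norm w = 1 \<Longrightarrow> ?f v \<le> ?f w"
    using continuous_attains_inf[of "sphere (0::real^'k) 1" ?f] by auto
  define \<mu> where "\<mu> = ?f v"
  have lower: "\<mu> * (w \<bullet> w) \<le> ?f w" for w
  proof (cases "w = 0")
    case False
    then have n: "norm w > 0" by simp
    have "\<mu> \<le> ?f ((1 / norm w) *\<^sub>R w)"
      unfolding \<mu>_def using n by (intro min) simp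
    also have "\<dots> = ?f w / (w \<bullet> w)"
      by (simp add: matrix_vector_mult_scaleR dot_square_norm power2_eq_square)
    finally show ?thesis
      using False by (simp add: field_simps)
  qed simp
  \<comment> \<open>\<open>g\<close> is half the gradient at \<open>v\<close> of the nonnegative
    form \<open>w \<bullet> (M *v w) - \<mu> * (w \<bullet> w)\<close>, which vanishes at
    \<open>v\<close>. A small step along \<open>- g\<close> would make the form negative unless
    \<open>g = 0\<close>.\<close>
  define g where "g = M *v v - \<mu> *\<^sub>R v"
  define q where "q = ?f g - \<mu> * (g \<bullet> g)"
  have q: "0 \<le> q" using lower[of g] by (simp add: q_def)
  have gg: "g \<bullet> (M *v v) - \<mu> * (g \<bullet> v) = g \<bullet> g"
    by (simp add: g_def inner_diff_right inner_diff_left algebra_simps)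
  have vv: "v \<bullet> v = 1" using v by (simp add: dot_square_norm)
  have pert: "0 \<le> s\<^sup>2 * q - 2 * s * (g \<bullet> g)" for s
  proof -
    have "0 \<le> ?f (v - s *\<^sub>R g) - \<mu> * ((v - s *\<^sub>R g) \<bullet> (v - s *\<^sub>R g))"
      using lower by simp
    also have "\<dots> = ?f v - \<mu> * (v \<bullet> v) - 2 * s * (g \<bullet> (M *v v) - \<mu> * (g \<bullet> v)) + s\<^sup>2 * q"
      unfolding q_def
      by (simp add: matrix_vector_mult_diff_distrib matrix_vector_mult_scaleR inner_diff_left
          inner_diff_right swap[of v g] inner_commute[of v g] algebra_simps power2_eq_square)
    finally show ?thesis by (simp add: vv gg flip: \<mu>_def)
  qed
  have "g \<bullet> g = 0"
  proof (rule ccontr)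
    assume "g \<bullet> g \<noteq> 0"
    then have pos: "g \<bullet> g > 0" by simp
    \<comment> \<open>The \<open>+ 1\<close> keeps the denominator positive when
      \<open>q = 0\<close> and yields \<open>s * q < g \<bullet> g\<close>, so the linear term
      wins.\<close>
    define s where "s = g \<bullet> g / (q + 1)"
    have s: "s > 0" using pos q by (simp add: s_def)
    have "0 \<le> s * (s * q - 2 * (g \<bullet> g))"
      using pert[of s] by (simp add: algebra_simps power2_eq_square)
    then have "2 * (g \<bullet> g) \<le> s * q"
      using s by (simp add: zero_le_mult_iff)
    moreover have "s * (q + 1) = g \<bullet> g"
      using q by (simp add: s_def)
    ultimately show False using s pos by (simp add: algebra_simps)
  qed
  then have "M *v v = \<mu> *\<^sub>R v" by (simp add: g_def)
  with v lower show thesis using that by blast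
qed

text \<open>Finiteness lets \<open>Min\<close> act as a lower bound on the singular values. Gram
  eigenvectors of distinct singular values are orthogonal and nonzero, hence independent.\<close>

lemma finite_singular_values: "finite (singular_values (M :: real^'k^'k))"
proof -
  let ?G = "transpose M ** M"
  obtain f where f: "\<And>s. s \<in> singular_values M \<Longrightarrow> f s \<noteq> 0 \<and> ?G *v f s = s\<^sup>2 *\<^sub>R f s"
    using bchoice[of "singular_values M" "\<lambda>s v. v \<noteq> 0 \<and> ?G *v v = s\<^sup>2 *\<^sub>R v"]
    by (auto simp: singular_values_def)
  have swap: "a \<bullet> (?G *v b) = b \<bullet> (?G *v a)" for a b
    by (metis dot_lmul_matrix inner_commute matrix_transpose_mul transpose_matrix_vector
        transpose_transpose)
  have orth: "f s \<bullet> f r = 0" if "s \<in> singular_values M" "r \<in> singular_values M" "s \<noteq> r" for s r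
  proof -
    have "s\<^sup>2 * (f s \<bullet> f r) = r\<^sup>2 * (f s \<bullet> f r)"
      using f[OF that(1)] f[OF that(2)] swap[of "f s" "f r"]
      by (metis inner_commute inner_scaleR_right)
    moreover have "s\<^sup>2 \<noteq> r\<^sup>2"
      using that by (auto simp: singular_values_def power2_eq_iff_nonneg)
    ultimately show ?thesis by simp
  qed
  have "inj_on f (singular_values M)"
    by (rule inj_onI) (metis f inner_eq_zero_iff orth)
  moreover have "finite (f ` singular_values M)"
  proof (intro independent_imp_finite pairwise_orthogonal_independent)
    show "pairwise orthogonal (f ` singular_values M)"
      unfolding pairwise_def orthogonal_def using orth by fastforce
    show "0 \<notin> f ` singular_values M" using f by force
  qed
  ultimately show ?thesis using finite_imageD by blast
qed

text \<open>The least eigenvalue \<open>\<mu>\<close> is nonnegative, and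
  \<open>\<mu>\<^sup>2\<close> is an eigenvalue of the Gram matrix of the symmetric
  \<open>M\<close>. So \<open>\<mu>\<close> is itself a singular value and \<open>Min\<close> lies
  below it.\<close>

lemma min_singular_value_le_quadratic_form:
  fixes M :: "real^'k^'k"
  assumes sym: "transpose M = M" and psd: "\<And>w. 0 \<le> w \<bullet> (M *v w)"
  shows "min_singular_value M * (w \<bullet> w) \<le> w \<bullet> (M *v w)"
proof -
  obtain v \<mu> where v: "norm v = 1" "M *v v = \<mu> *\<^sub>R v"
    and low: "\<And>w. \<mu> * (w \<bullet> w) \<le> w \<bullet> (M *v w)"
    using min_eigenvector[OF sym] by blast
  have "0 \<le> \<mu>" using psd[of v] v by (simp add: dot_square_norm)
  moreover have "(transpose M ** M) *v v = \<mu>\<^sup>2 *\<^sub>R v"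
    by (simp add: sym v matrix_vector_mul_assoc[symmetric] matrix_vector_mult_scaleR power2_eq_square)
  moreover have "v \<noteq> 0" using v by auto
  ultimately have "\<mu> \<in> singular_values M" by (auto simp: singular_values_def)
  then have "min_singular_value M \<le> \<mu>"
    unfolding min_singular_value_def by (intro Min_le finite_singular_values)
  then show ?thesis using low[of w] by (meson inner_ge_zero mult_right_mono order_trans)
qed

subsection \<open>Least squares in the Frobenius norm\<close>

text \<open>The estimation error is bounded in the Frobenius norm first; this passes to the spectral
  norm, by Cauchy-Schwarz on each row.\<close>

lemma spectral_norm_le_norm: "spectral_norm (M :: real^'c^'r) \<le> norm M"
  unfolding spectral_norm_def
proof (rule onorm_bound)
  fix v
  have "norm (M *v v) = L2_set (\<lambda>i. \<bar>M $ i \<bullet> v\<bar>) UNIV"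
    by (simp add: norm_vec_def matrix_vector_mul_component)
  also have "\<dots> \<le> L2_set (\<lambda>i. norm (M $ i) * norm v) UNIV"
    by (intro L2_set_mono) (auto simp: Cauchy_Schwarz_ineq2)
  also have "\<dots> = norm M * norm v"
    by (simp add: norm_vec_def[of M] L2_set_left_distrib)
  finally show "norm (M *v v) \<le> norm M * norm v" .
qed simp

lemma norm_matrix_vector_le_spectral_norm: "norm (M *v v) \<le> spectral_norm M * norm v"
  unfolding spectral_norm_def by (rule onorm) simp

text \<open>The rows of \<open>M ** D\<close> are \<open>transpose D\<close> applied to the rows of
  \<open>M\<close>, so a lower bound on vectors carries over row by row.\<close>

lemma norm_matrix_mult_ge:
  fixes D :: "real^'l^'k" and M :: "real^'k^'n"
  assumes "c \<ge> 0" and "\<And>y. c * norm y \<le> norm (transpose D *v y)"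
  shows "c * norm M \<le> norm (M ** D)"
proof -
  have row: "(M ** D) $ i = transpose D *v (M $ i)" for i
    by (simp add: vec_eq_iff matrix_matrix_mult_def matrix_vector_mult_def transpose_def mult.commute)
  have "c * norm M = L2_set (\<lambda>i. c * norm (M $ i)) UNIV"
    using assms(1) by (simp add: norm_vec_def[of M] L2_set_right_distrib)
  also have "\<dots> \<le> norm (M ** D)"
    unfolding norm_vec_def[of "M ** D"] row using assms by (intro L2_set_mono) auto
  finally show ?thesis .
qed

text \<open>The squared Frobenius norm is also the sum of the squared column norms.\<close>

lemma norm_le_of_columns:
  fixes M :: "real^'l^'n"
  assumes "\<And>k. norm (column k M) \<le> c"
  shows "norm M \<le> sqrt (real CARD('l)) * c"
proof -
  have c: "0 \<le> c" using assms norm_ge_zero order_trans by blast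
  have "(norm M)\<^sup>2 = (\<Sum>i\<in>UNIV. \<Sum>k\<in>UNIV. (M $ i $ k)\<^sup>2)"
    by (simp add: norm_vec_def L2_set_def sum_nonneg)
  also have "\<dots> = (\<Sum>k\<in>UNIV. (norm (column k M))\<^sup>2)"
    by (subst sum.swap) (simp add: norm_vec_def L2_set_def sum_nonneg column_def)
  also have "\<dots> \<le> (\<Sum>k\<in>(UNIV :: 'l set). c\<^sup>2)"
    by (intro sum_mono power_mono assms) auto
  also have "\<dots> = (sqrt (real CARD('l)) * c)\<^sup>2"
    by (simp add: power_mult_distrib)
  finally show ?thesis using c by (simp add: power2_le_iff_abs_le)
qed

text \<open>Minimising over pairs \<open>(B, A)\<close> thus amounts to minimising over all matrices
  of the block shape.\<close>

lemma hcat_surj: "\<exists>B A. hcat B A = \<Theta>"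
proof (intro exI)
  show "hcat (\<chi> i p. \<Theta> $ i $ Inl p) (\<chi> i q. \<Theta> $ i $ Inr q) = \<Theta>"
    by (simp add: hcat_def vec_eq_iff split: sum.split)
qed

lemma hcat_mult_vstack: "hcat B A *v vstack u x = B *v u + A *v x"
  by (simp add: vec_eq_iff matrix_vector_mult_def hcat_def vstack_def sum.Plus
      flip: UNIV_Plus_UNIV)

text \<open>The fitted product is a closest point to \<open>X\<close> in a subspace. Only this
  product is compared, so the argument covers rank-deficient \<open>D\<close>, where the minimiser
  is not unique.\<close>

lemma ls_estimate_nonexpansive:
  fixes X :: "real^'l^'n" and D :: "real^'l^('m::finite + 'n)"
  assumes est: "ls_estimate X D = (Bhat, Ahat)"
  shows "norm ((hcat Bhat Ahat - \<Theta>) ** D) \<le> norm (X - \<Theta> ** D)"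
proof -
  define S where "S = range (\<lambda>\<Theta> :: real^('m + 'n)^'n. \<Theta> ** D)"
  have "linear (\<lambda>\<Theta> :: real^('m + 'n)^'n. \<Theta> ** D)"
    by (intro linearI) (simp_all add: vec_eq_iff matrix_matrix_mult_def distrib_right sum.distrib
        sum_distrib_left mult.assoc)
  then have S: "subspace S" unfolding S_def by (rule linear_subspace_image) simp
  have cl: "closed S" and cv: "convex S"
    by (rule closed_subspace[OF S]) (rule subspace_imp_convex[OF S])
  have ne: "S \<noteq> {}" by (simp add: S_def)
  have S_hcat: "\<exists>B A. Q = hcat B A ** D" if "Q \<in> S" for Q
    using that hcat_surj unfolding S_def by (metis imageE)
  obtain P where "P \<in> S" and P: "\<And>Q. Q \<in> S \<Longrightarrow> dist X P \<le> dist X Q"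
    using distance_attains_inf[OF cl ne, of X] by blast
  then obtain B0 A0 where "P = hcat B0 A0 ** D" using S_hcat by blast
  \<comment> \<open>\<open>ARG_MIN\<close> is a choice operator: the estimate is known to minimise
    only once some minimiser is exhibited.\<close>
  then have "is_arg_min (\<lambda>(B, A). norm (X - hcat B A ** D)) (\<lambda>_. True) (B0, A0)"
    unfolding is_arg_min_linorder using P by (auto simp: S_def dist_norm)
  then have "is_arg_min (\<lambda>(B, A). norm (X - hcat B A ** D)) (\<lambda>_. True) (Bhat, Ahat)"
    unfolding est[unfolded ls_estimate_def arg_min_def, symmetric] by (rule someI)
  then have min: "norm (X - hcat Bhat Ahat ** D) \<le> norm (X - hcat B A ** D)" for B A
    unfolding is_arg_min_linorder by auto
  let ?P = "hcat Bhat Ahat ** D" and ?Q = "\<Theta> ** D"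
  have "\<forall>Q\<in>S. dist X ?P \<le> dist X Q"
  proof
    fix Q assume "Q \<in> S"
    then obtain B A where "Q = hcat B A ** D" using S_hcat by blast
    then show "dist X ?P \<le> dist X Q" using min by (simp add: dist_norm)
  qed
  \<comment> \<open>The obtuse-angle criterion for closest points of convex sets makes the cross
    term below favourable.\<close>
  then have obtuse: "(X - ?P) \<bullet> (?Q - ?P) \<le> 0"
    by (intro any_closest_point_dot[OF cv cl]) (simp_all add: S_def)
  have "(norm (X - ?Q))\<^sup>2 = (norm (X - ?P))\<^sup>2 + (norm (?P - ?Q))\<^sup>2 - 2 * ((X - ?P) \<bullet> (?Q - ?P))"
    by (simp add: power2_norm_eq_inner inner_diff_left inner_diff_right inner_commute)
  then have "(norm (?P - ?Q))\<^sup>2 \<le> (norm (X - ?Q))\<^sup>2"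
    using obtuse zero_le_power2[of "norm (X - ?P)"] by linarith
  moreover have "(hcat Bhat Ahat - \<Theta>) ** D = ?P - ?Q"
    by (simp add: vec_eq_iff matrix_matrix_mult_def left_diff_distrib sum_subtractf)
  ultimately show ?thesis by simp
qed

subsection \<open>The normalised data\<close>

text \<open>These bounds are the purpose of the normalisation: dividing by \<open>nfac\<close> does
  not enlarge the noise and shrinks the regressor to norm at most 1.\<close>

lemma nfac_ge_1: "1 \<le> nfac u x s" and norm_vstack_le_nfac: "norm (vstack (u s) (x s)) \<le> nfac u x s"
  unfolding nfac_def by (simp, rule real_le_rsqrt, simp)

lemma nfac_pos: "0 < nfac u x s"
  using nfac_ge_1[of u x s] by linarith

lemma matrix_inv_N_mat:
  "matrix_inv (N_mat u x t :: real^'l::{finite,linorder}^'l::{finite,linorder}) =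
    (\<chi> j k. if j = k then 1 / nfac u x (sample_time t k) else 0)"
proof -
  let ?N = "N_mat u x t :: real^'l::{finite,linorder}^'l::{finite,linorder}"
  let ?I = "(\<chi> j k. if j = k then 1 / nfac u x (sample_time t k) else 0) :: real^'l::{finite,linorder}^'l::{finite,linorder}"
  have nz: "nfac u x s \<noteq> 0" for s using nfac_pos[of u x s] by simp
  have 1: "?N ** ?I = mat 1"
    using nz by (auto simp: vec_eq_iff matrix_matrix_mult_def N_mat_def mat_def
        if_distrib[where f="\<lambda>z. z * _"] if_distrib[where f="\<lambda>z. _ * z"] cong: if_cong)
  then have 2: "?I ** ?N = mat 1" using matrix_left_right_inverse by blast
  \<comment> \<open>\<open>matrix_inv\<close> is also a choice; \<open>?I\<close> witnesses
    existence, and uniqueness of inverses then identifies the two.\<close>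
  have "?N ** matrix_inv ?N = mat 1"
    unfolding matrix_inv_def
    using someI[of "\<lambda>Z. ?N ** Z = mat 1 \<and> Z ** ?N = mat 1" ?I] 1 2 by blast
  then have "?I = (?I ** ?N) ** matrix_inv ?N"
    by (simp only: matrix_mul_assoc[symmetric] matrix_mul_rid)
  then show ?thesis by (simp only: 2 matrix_mul_lid)
qed

lemma column_mult_matrix_inv_N_mat:
  fixes Y :: "real^'l::{finite,linorder}^'k"
  shows "column k (Y ** matrix_inv (N_mat u x t)) = (1 / nfac u x (sample_time t k)) *\<^sub>R column k Y"
  by (simp add: matrix_inv_N_mat vec_eq_iff column_def matrix_matrix_mult_def
      if_distrib[where f="\<lambda>z. _ * z"] cong: if_cong)

lemma column_matrix_mult: "column k (M ** D) = (M :: real^'k^'n) *v column k D"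
  by (simp add: vec_eq_iff column_def matrix_matrix_mult_def matrix_vector_mult_def)

text \<open>Scaling by the diagonal inverse acts columnwise, so the matrix residual splits into
  single-sample prediction errors.\<close>

lemma column_residual:
  fixes \<Theta> :: "real^('m::finite + 'n::finite)^'n"
  shows "column k (Xbar_next u x t - \<Theta> ** (Dbar u x t :: real^'l::{finite,linorder}^('m + 'n))) =
    (1 / nfac u x (sample_time t k)) *\<^sub>R
      (x (Suc (sample_time t k)) - \<Theta> *v vstack (u (sample_time t k)) (x (sample_time t k)))"
proof -
  have "column k (Y - Z) = column k Y - column k Z" for Y Z :: "real^'l::{finite,linorder}^'n"
    by (simp add: vec_eq_iff column_def)
  moreover have "column k (Xnext_mat x t :: real^'l::{finite,linorder}^'n) = x (Suc (sample_time t k))"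
    "column k (D_mat u x t :: real^'l::{finite,linorder}^('m + 'n)) = vstack (u (sample_time t k)) (x (sample_time t k))"
    by (simp_all add: vec_eq_iff column_def Xnext_mat_def D_mat_def)
  ultimately show ?thesis
    unfolding Xbar_next_def Dbar_def
    by (simp add: column_matrix_mult[of k \<Theta>] column_mult_matrix_inv_N_mat matrix_vector_mult_scaleR
        scaleR_diff_right)
qed

section \<open>Window times, switching instants and parameter drift\<close>

lemma sample_time_bounds:
  fixes k :: "'l::{finite,linorder}"
  assumes "CARD('l) \<le> t"
  shows "t - CARD('l) \<le> sample_time t k" "sample_time t k < t"
proof -
  have "colpos k < CARD('l)"
    unfolding colpos_def by (intro psubset_card_mono) auto
  then show "t - CARD('l) \<le> sample_time t k" "sample_time t k < t"
    using assms by (auto simp: sample_time_def)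
qed

text \<open>Dwell times telescope. Subtraction truncates, but a difference of at least a positive
  \<open>\<tau>\<close> is a genuine increase.\<close>

lemma switching_instants_gap:
  fixes T :: "nat \<Rightarrow> nat"
  assumes dwell: "\<And>i. T (Suc i) - T i \<ge> \<tau>" and "\<tau> > 0"
  shows "T j + d * \<tau> \<le> T (j + d)"
proof (induction d)
  case (Suc d)
  with dwell[of "j + d"] \<open>\<tau> > 0\<close> show ?case by simp
qed simp

text \<open>Telescoping with the triangle inequality, applied to a vector because only the action on
  a regressor matters.\<close>

lemma parameter_drift:
  fixes \<Theta> :: "nat \<Rightarrow> real^'k^'n"
  assumes "\<And>i. i \<ge> 1 \<Longrightarrow> spectral_norm (\<Theta> i - \<Theta> (i - 1)) \<le> \<delta>"
  shows "norm ((\<Theta> j - \<Theta> (j + d)) *v v) \<le> real d * \<delta> * norm v"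
proof (induction d)
  case (Suc d)
  let ?E = "\<Theta> (j + Suc d) - \<Theta> (j + d)"
  have "norm (?E *v v) \<le> \<delta> * norm v"
    using norm_matrix_vector_le_spectral_norm[of ?E v] assms[of "j + Suc d"]
      mult_right_mono[of "spectral_norm ?E" \<delta> "norm v"] by simp
  moreover have "(\<Theta> j - \<Theta> (j + Suc d)) *v v = (\<Theta> j - \<Theta> (j + d)) *v v - ?E *v v"
    by (simp add: matrix_vector_mult_diff_rdistrib)
  ultimately show ?case
    using Suc norm_triangle_ineq4[of "(\<Theta> j - \<Theta> (j + d)) *v v" "?E *v v"]
    by (simp add: algebra_simps)
qed simp

theorem lemma3:
  fixes A :: "nat \<Rightarrow> real^'n^'n" and B :: "nat \<Rightarrow> real^'m^'n"
    and x :: "nat \<Rightarrow> real^'n" and u :: "nat \<Rightarrow> real^'m" and w :: "nat \<Rightarrow> real^'n"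
    and K :: "nat \<Rightarrow> real^'n^'m" and e :: "nat \<Rightarrow> real^'m"
    and T :: "nat \<Rightarrow> nat" and t0 \<tau> L N :: nat
    and a_m b_m w_m \<delta> e_m \<gamma> :: real
  assumes L_def: "L = CARD('l::{finite,linorder})"
    and L_ge: "L \<ge> CARD('m) + CARD('n)"
    and tau_pos: "\<tau> > 0"
    and t0_def: "t0 = T 0"
    and offline_window: "L \<le> t0"
    and dwell: "\<And>i. T (Suc i) - T i \<ge> \<tau>"
    and dynamics: "\<And>i t. T i \<le> t \<Longrightarrow> t < T (Suc i) \<Longrightarrow>
          x (Suc t) = A i *v x t + B i *v u t + w t"
    and offline_dynamics: "\<And>t. t0 - L \<le> t \<Longrightarrow> t < t0 \<Longrightarrow>
          x (Suc t) = A 0 *v x t + B 0 *v u t + w t"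
    and input: "\<And>t. u t = K t *v x t + e t"
    and controllable: "\<And>i. controllable (A i) (B i)"
    and A_bound: "\<And>i. spectral_norm (A i) \<le> a_m"
    and B_bound: "\<And>i. spectral_norm (B i) \<le> b_m"
    and w_m_nonneg: "w_m \<ge> 0"
    and w_bound: "\<And>t. norm (w t) \<le> w_m"
    and delta_pos: "\<delta> > 0"
    and variation: "\<And>i. i \<ge> 1 \<Longrightarrow>
          spectral_norm (hcat (B i) (A i) - hcat (B (i - 1)) (A (i - 1))) \<le> \<delta>"
    and e_m_pos: "e_m > 0"
    and gamma_pos: "\<gamma> > 0"
    and excitation: "\<And>t. t \<ge> t0 \<Longrightarrow>
          min_singular_value ((1 / real L) *\<^sub>R
            ((Dbar u x t :: real^'l::{finite,linorder}^('m + 'n)) ** transpose (Dbar u x t))) \<ge> \<gamma>\<^sup>2"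
    and e_bound: "\<And>t. norm (e t) \<le> e_m"
    and N_def: "N = nat \<lceil>real L / real \<tau>\<rceil>"
  shows "\<forall>i t. T i \<le> t \<and> t < T (Suc i) \<longrightarrow>
    (case ls_estimate (Xbar_next u x t) (Dbar u x t :: real^'l::{finite,linorder}^('m + 'n)) of
      (Bhat, Ahat) \<Rightarrow>
        spectral_norm (hcat Bhat Ahat - hcat (B i) (A i)) \<le> real N * \<delta> / \<gamma> + w_m / \<gamma>)"
proof (intro allI impI)
  fix i t assume "T i \<le> t \<and> t < T (Suc i)"
  then have it: "T i \<le> t" "t < T (Suc i)" by auto
  define \<Theta> where "\<Theta> j = hcat (B j) (A j)" for j
  let ?D = "Dbar u x t :: real^'l::{finite,linorder}^('m + 'n)"
  let ?X = "Xbar_next u x t :: real^'l::{finite,linorder}^'n"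
  have L_pos: "L > 0" by (simp add: L_def)
  have gap: "T j + d * \<tau> \<le> T (j + d)" for j d using dwell tau_pos by (rule switching_instants_gap)
  have T0: "t0 \<le> T i" using gap[of 0 i] t0_def by simp
  \<comment> \<open>A full window is available, so \<open>t - L\<close> does not truncate.\<close>
  then have Lt: "CARD('l) \<le> t" using it offline_window L_def by simp

  have mode: "\<exists>j d. i = j + d \<and> d \<le> N \<and> x (Suc s) = \<Theta> j *v vstack (u s) (x s) + w s"
    if s: "t - L \<le> s" "s < t" for s
  proof -
    \<comment> \<open>Among \<open>d\<close> switches in the window only \<open>d - 1\<close> dwell
      intervals need fit between the first and the last, and
      \<open>d - 1 < L / \<tau> \<le> N\<close> still gives \<open>d \<le> N\<close>.\<close>
    have few: "d \<le> N" if "(d - 1) * \<tau> < L" for d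
    proof -
      have "real (d - 1) < real L / real \<tau>"
        using that tau_pos by (simp add: field_simps flip: of_nat_mult)
      also have "\<dots> \<le> real N" unfolding N_def by (rule real_nat_ceiling_ge)
      finally show ?thesis by linarith
    qed
    have step: "x (Suc s) = A j *v x s + B j *v u s + w s \<Longrightarrow>
        x (Suc s) = \<Theta> j *v vstack (u s) (x s) + w s" for j
      by (simp add: \<Theta>_def hcat_mult_vstack)
    show ?thesis
    proof (cases "s < t0")
      case True
      \<comment> \<open>An offline sample obeys mode 0. It precedes \<open>T 0\<close>, so all
        \<open>i\<close> dwell intervals up to \<open>T i\<close> lie inside the window.\<close>
      have "i * \<tau> < L"
        using gap[of 0 i] it True s t0_def by simp
      then have "i \<le> N"
        by (intro few) (meson diff_le_self le_less_trans mult_le_mono1)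
      moreover have "t0 - L \<le> s" using T0 it s by simp
      ultimately have "i = 0 + i \<and> i \<le> N \<and> x (Suc s) = \<Theta> 0 *v vstack (u s) (x s) + w s"
        using step[OF offline_dynamics] True by simp
      then show ?thesis by blast
    next
      case False
      \<comment> \<open>The mode active at \<open>s\<close>: the last switch not after
        \<open>s\<close>. It exists since \<open>T 0 \<le> s\<close>, and later modes than
        \<open>i\<close> start after \<open>t\<close>.\<close>
      define j where "j = (GREATEST j. T j \<le> s)"
      have le: "j' \<le> i" if "T j' \<le> s" for j'
      proof (rule ccontr)
        assume "\<not> j' \<le> i"
        then have "T (Suc i) \<le> T j'" using gap[of "Suc i" "j' - Suc i"] by simp
        then show False using that s it by simp
      qed
      have T: "T j \<le> s"
        unfolding j_def by (rule GreatestI_nat[where k = 0 and b = i]) (use False t0_def le in auto)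
      have "j' \<le> j" if "T j' \<le> s" for j'
        unfolding j_def using that by (rule Greatest_le_nat[where b = i]) (use le in auto)
      from this[of "Suc j"] have T': "s < T (Suc j)" by linarith
      have ji: "j \<le> i" using le T by simp
      \<comment> \<open>The switches \<open>T (Suc j)\<close> to \<open>T i\<close> lie after
        \<open>s\<close> and not after \<open>t\<close>. For \<open>j = i\<close> there are none,
        and the truncated count is 0.\<close>
      have "(i - j - 1) * \<tau> < L"
      proof (cases "j = i")
        case False
        then have "T (Suc j) + (i - j - 1) * \<tau> \<le> T i"
          using gap[of "Suc j" "i - j - 1"] ji by simp
        then show ?thesis using it s T' by simp
      qed (simp add: L_pos)
      then have "i - j \<le> N" by (rule few)
      then have "i = j + (i - j) \<and> i - j \<le> N \<and> x (Suc s) = \<Theta> j *v vstack (u s) (x s) + w s"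
        using step[OF dynamics[OF T T']] ji by simp
      then show ?thesis by blast
    qed
  qed

  define c where "c = real N * \<delta> + w_m"
  have res: "norm (?X - \<Theta> i ** ?D) \<le> sqrt (real L) * c"
    unfolding L_def
  proof (rule norm_le_of_columns)
    fix k :: 'l
    define s where "s = sample_time t k"
    define n where "n = nfac u x s"
    let ?d = "vstack (u s) (x s)"
    have n: "1 \<le> n" "norm ?d \<le> n" "0 < n"
      unfolding n_def by (rule nfac_ge_1 norm_vstack_le_nfac nfac_pos)+
    obtain j d where jd: "i = j + d" "d \<le> N" "x (Suc s) = \<Theta> j *v ?d + w s"
      using mode[of s] sample_time_bounds[OF Lt, of k] unfolding s_def L_def by blast
    have "x (Suc s) - \<Theta> i *v ?d = (\<Theta> j - \<Theta> i) *v ?d + w s"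
      by (simp add: jd matrix_vector_mult_diff_rdistrib)
    then have "norm (x (Suc s) - \<Theta> i *v ?d) \<le> norm ((\<Theta> j - \<Theta> i) *v ?d) + norm (w s)"
      by (simp add: norm_triangle_ineq)
    also have "\<dots> \<le> real d * \<delta> * norm ?d + w_m"
      using parameter_drift[of \<Theta> \<delta> j d ?d] variation w_bound[of s] jd(1)
      by (simp add: \<Theta>_def add_mono)
    \<comment> \<open>Both terms acquire the factor \<open>n\<close>: the drift from
      \<open>norm ?d \<le> n\<close>, the noise from \<open>1 \<le> n\<close>.\<close>
    also have "\<dots> \<le> real N * \<delta> * n + w_m * n"
      using n jd(2) delta_pos mult_left_mono[OF n(1) w_m_nonneg]
      by (intro add_mono mult_mono) simp_all
    finally have "norm (x (Suc s) - \<Theta> i *v ?d) \<le> c * n" by (simp add: c_def algebra_simps)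
    then have "norm (x (Suc s) - \<Theta> i *v ?d) / n \<le> c"
      using n(3) by (simp add: pos_divide_le_eq)
    then show "norm (column k (?X - \<Theta> i ** ?D)) \<le> c"
      unfolding column_residual s_def[symmetric] n_def[symmetric] norm_scaleR using n(3) by simp
  qed

  have expand: "sqrt (real L) * \<gamma> * norm y \<le> norm (transpose ?D *v y)" for y
  proof -
    define M where "M = (1 / real L) *\<^sub>R (?D ** transpose ?D)"
    \<comment> \<open>The form of the scaled Gram matrix is a squared norm over \<open>L\<close>; it
      is nonnegative, and clearing \<open>L\<close> produces the factor
      \<open>sqrt L\<close>.\<close>
    have form: "z \<bullet> (M *v z) = (norm (transpose ?D *v z))\<^sup>2 / real L" for z
      unfolding M_def
      by (simp add: scaleR_matrix_vector_assoc[symmetric] matrix_vector_mul_assoc[symmetric]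
          dot_lmul_matrix[symmetric] power2_norm_eq_inner)
    have "transpose M = M"
      by (simp add: M_def transpose_scalar matrix_transpose_mul)
    then have "min_singular_value M * (y \<bullet> y) \<le> (norm (transpose ?D *v y))\<^sup>2 / real L"
      unfolding form[symmetric] by (rule min_singular_value_le_quadratic_form) (simp add: form)
    moreover have "\<gamma>\<^sup>2 \<le> min_singular_value M"
      unfolding M_def using excitation T0 it by simp
    ultimately have "\<gamma>\<^sup>2 * (y \<bullet> y) \<le> (norm (transpose ?D *v y))\<^sup>2 / real L"
      by (meson inner_ge_zero mult_right_mono order_trans)
    then have "(sqrt (real L) * \<gamma> * norm y)\<^sup>2 \<le> (norm (transpose ?D *v y))\<^sup>2"
      using L_pos by (simp add: power_mult_distrib power2_norm_eq_inner field_simps)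
    then show ?thesis by (rule power2_le_imp_le) simp
  qed

  obtain Bhat Ahat where est: "ls_estimate ?X ?D = (Bhat, Ahat)" by fastforce
  let ?E = "hcat Bhat Ahat - \<Theta> i"
  have "sqrt (real L) * \<gamma> * norm ?E \<le> norm (?E ** ?D)"
    using gamma_pos expand by (intro norm_matrix_mult_ge) auto
  also have "\<dots> \<le> sqrt (real L) * c"
    using ls_estimate_nonexpansive[OF est, of "\<Theta> i"] res by simp
  \<comment> \<open>The \<open>sqrt L\<close> from counting columns cancels the one from the
    excitation condition, leaving a bound without this factor.\<close>
  finally have "\<gamma> * norm ?E \<le> c" using L_pos by simp
  then have "norm ?E \<le> real N * \<delta> / \<gamma> + w_m / \<gamma>"
    using gamma_pos by (simp add: c_def field_simps)
  then have "spectral_norm ?E \<le> real N * \<delta> / \<gamma> + w_m / \<gamma>"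
    using spectral_norm_le_norm order_trans by blast
  then show "case ls_estimate ?X ?D of (Bhat, Ahat) \<Rightarrow>
      spectral_norm (hcat Bhat Ahat - hcat (B i) (A i)) \<le> real N * \<delta> / \<gamma> + w_m / \<gamma>"
    by (simp add: est \<Theta>_def)
qed

end
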